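(* Let $R$ be a commutative ring (not necessarily with identity). Then $R$ satisfies $$\text{(BLR-1)}\qquad I\cap J=I\cdot (I\to J)\quad\text{for all ideals } I,J \text{ of } R$$ if and only if $R$ is a multiplication ring.
   Context: Rings are commutative and are not assumed to have an identity. For ideals $I,J$ of $R$, $I\cdot J$ is the usual product ideal and $I\to J:=\{x\in R: xI\subseteq J\}$. A commutative ring $R$ is a multiplication ring if for all ideals $I,J$ of $R$ with $I\subseteq J$ there exists an ideal $K$ of $R$ such that $I=J\cdot K$. *)

theory Defs
  imports Main
begin

(* The class comm_ring requires no multiplicative identity (that is comm_ring_1);
   the ring R is the whole type 'a. *)

definition ideal :: "'a::comm_ring set \<Rightarrow> bool" where
  "ideal I \<longleftrightarrow>
     0 \<in> I \<and> (\<forall>x\<in>I. \<forall>y\<in>I. x - y \<in> I) \<and> (\<forall>x\<in>I. \<forall>r. r * x \<in> I)"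

definition ideal_prod :: "'a::comm_ring set \<Rightarrow> 'a set \<Rightarrow> 'a set"  (infixl "\<cdot>" 70) where
  "I \<cdot> J = {\<Sum>i<n. a i * b i | (n::nat) a b. (\<forall>i<n. a i \<in> I \<and> b i \<in> J)}"

definition residual :: "'a::comm_ring set \<Rightarrow> 'a set \<Rightarrow> 'a set"  (infixr "\<rightarrow>" 75) where
  "(I \<rightarrow> J) = {x. \<forall>y\<in>I. x * y \<in> J}"

definition BLR1 :: "'a::comm_ring itself \<Rightarrow> bool" where
  "BLR1 _ \<longleftrightarrow>
     (\<forall>I J :: 'a set. ideal I \<longrightarrow> ideal J \<longrightarrow> I \<inter> J = I \<cdot> (I \<rightarrow> J))"

definition multiplication_ring :: "'a::comm_ring itself \<Rightarrow> bool" where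
  "multiplication_ring _ \<longleftrightarrow>
     (\<forall>I J :: 'a set. ideal I \<longrightarrow> ideal J \<longrightarrow> I \<subseteq> J \<longrightarrow>
        (\<exists>K. ideal K \<and> I = J \<cdot> K))"

end

theory Submission
  imports Defs
begin

text \<open>
  Both conditions are governed by the adjunction between \<open>I \<cdot> _\<close> and \<open>I \<rightarrow> _\<close>:
  \<open>I \<rightarrow> J\<close> is the largest ideal whose product with \<open>I\<close> lies in \<open>J\<close>
  (lemmas \<open>ideal_residual\<close>, \<open>ideal_prod_residual_subset\<close> and \<open>subset_residual\<close>).

  If (BLR-1) holds and \<open>I \<subseteq> J\<close>, then \<open>I = J \<inter> I = J \<cdot> (J \<rightarrow> I)\<close>, so \<open>J \<rightarrow> I\<close> is the
  required cofactor. Conversely, in a multiplication ring \<open>I \<inter> J\<close> is a multiple \<open>I \<cdot> K\<close> of the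
  larger ideal \<open>I\<close>. As \<open>I \<cdot> K \<subseteq> J\<close>, maximality gives \<open>K \<subseteq> I \<rightarrow> J\<close>, and hence
  \<open>I \<inter> J \<subseteq> I \<cdot> (I \<rightarrow> J)\<close>; the other inclusion holds in every commutative ring.
\<close>

lemma ideal_add:
  assumes "ideal I" "x \<in> I" "y \<in> I"
  shows "x + y \<in> I"
proof -
  have "0 - y \<in> I"
    using assms unfolding ideal_def by blast
  then have "x - (0 - y) \<in> I"
    using assms unfolding ideal_def by blast
  then show ?thesis
    by simp
qed

lemma ideal_sum:
  assumes "ideal I" "\<And>i. i < n \<Longrightarrow> f i \<in> I"
  shows "(\<Sum>i<(n::nat). f i) \<in> I"
  using assms(2)
proof (induction n)
  case 0
  then show ?case
    using assms(1) by (simp add: ideal_def)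
next
  case (Suc n)
  then show ?case
    by (simp add: ideal_add[OF assms(1)])
qed

lemma ideal_Int: "ideal I \<Longrightarrow> ideal J \<Longrightarrow> ideal (I \<inter> J)"
  unfolding ideal_def by blast

lemma ideal_residual:
  assumes "ideal J"
  shows "ideal (I \<rightarrow> J)"
  using assms unfolding ideal_def residual_def
  by (auto simp: left_diff_distrib mult.assoc)

lemma mult_in_ideal_prod:
  assumes "x \<in> I" "y \<in> J"
  shows "x * y \<in> I \<cdot> J"
  unfolding ideal_prod_def
  using assms
  by (intro CollectI exI[of _ "1::nat"] exI[of _ "\<lambda>_. x"] exI[of _ "\<lambda>_. y"]) simp

lemma ideal_prod_subset:
  assumes "ideal L" "\<And>x y. x \<in> I \<Longrightarrow> y \<in> J \<Longrightarrow> x * y \<in> L"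
  shows "I \<cdot> J \<subseteq> L"
  unfolding ideal_prod_def using assms by (auto intro!: ideal_sum)

lemma ideal_prod_mono_right: "J \<subseteq> K \<Longrightarrow> I \<cdot> J \<subseteq> I \<cdot> K"
  unfolding ideal_prod_def by blast

lemma subset_residual:
  assumes "I \<cdot> K \<subseteq> J"
  shows "K \<subseteq> I \<rightarrow> J"
proof
  fix k assume "k \<in> K"
  then have "y * k \<in> J" if "y \<in> I" for y
    using assms mult_in_ideal_prod[OF that] by blast
  then show "k \<in> I \<rightarrow> J"
    by (simp add: residual_def mult.commute)
qed

lemma ideal_prod_residual_subset:
  assumes "ideal I" "ideal J"
  shows "I \<cdot> (I \<rightarrow> J) \<subseteq> I \<inter> J"
proof (rule ideal_prod_subset[OF ideal_Int[OF assms]])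
  fix x y assume "x \<in> I" "y \<in> I \<rightarrow> J"
  then have "y * x \<in> I \<inter> J"
    using assms(1) by (auto simp: ideal_def residual_def)
  then show "x * y \<in> I \<inter> J"
    by (simp add: mult.commute)
qed

theorem proposition2p2:
  "BLR1 TYPE('a::comm_ring) \<longleftrightarrow> multiplication_ring TYPE('a)"
proof
  assume BLR1: "BLR1 TYPE('a)"
  show "multiplication_ring TYPE('a)"
    unfolding multiplication_ring_def
  proof (intro allI impI)
    fix I J :: "'a set"
    assume I: "ideal I" and J: "ideal J" and "I \<subseteq> J"
    then have "I = J \<inter> I"
      by blast
    also have "\<dots> = J \<cdot> (J \<rightarrow> I)"
      using BLR1 I J unfolding BLR1_def by blast
    finally show "\<exists>K. ideal K \<and> I = J \<cdot> K"
      using ideal_residual[OF I] by blast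
  qed
next
  assume mult: "multiplication_ring TYPE('a)"
  show "BLR1 TYPE('a)"
    unfolding BLR1_def
  proof (intro allI impI)
    fix I J :: "'a set"
    assume I: "ideal I" and J: "ideal J"
    obtain K where K: "I \<inter> J = I \<cdot> K"
      using mult I ideal_Int[OF I J] unfolding multiplication_ring_def
      by (meson Int_lower1)
    then have "K \<subseteq> I \<rightarrow> J"
      by (intro subset_residual) blast
    then have "I \<inter> J \<subseteq> I \<cdot> (I \<rightarrow> J)"
      unfolding K by (rule ideal_prod_mono_right)
    then show "I \<inter> J = I \<cdot> (I \<rightarrow> J)"
      using ideal_prod_residual_subset[OF I J] by blast
  qed
qed

end
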